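(* The left division $\lhd$ and the right division $\rhd$ on the monomials of $R\langle x_1,\dots,x_n\rangle$ are continuous.
   Context: Monomials are words in the noncommuting variables $x_1,\dots,x_n$. An involutive division is a rule $I$ assigning to any finite set $U$ of monomials and any $u\in U$ a set $\mathcal M^L_I(u,U)\subseteq\{x_1,\dots,x_n\}$ of left multiplicative variables and a set $\mathcal M^R_I(u,U)\subseteq\{x_1,\dots,x_n\}$ of right multiplicative variables; the remaining variables are called left (respectively right) nonmultiplicative for $u$. For $u\in U$ and a monomial $v$, write $u\mid_I v$ ($u$ involutively divides $v$) if $v=v_1uv_2$ for some monomials $v_1,v_2$ such that the last letter of $v_1$ (if it exists) lies in $\mathcal M^L_I(u,U)$ and the first letter of $v_2$ (if it exists) lies in $\mathcal M^R_I(u,U)$ (thin divisors). Left division $\lhd$: for any monomial $u$ (independently of $U$), all variables are left multiplicative and all variables are right nonmultiplicative. Right division $\rhd$: for any monomial $u$ (independently of $U$), all variables are left nonmultiplicative and all variables are right multiplicative. Continuity. Let $I$ be a fixed involutive division, let $w$ be a fixed monomial, let $U$ be any set of monomials, and consider any sequence $(u_1,u_2,\dots,u_k)$ of monomials from $U$, each of which is a conventional divisor of $w$, so that $w=\ell_iu_ir_i$ for all $1\le i\le k$, where the $\ell_i$ and $r_i$ are monomials. For all $1\le i<k$, suppose that $u_{i+1}$ satisfies exactly one of the following conditions: (a) $\deg(\ell_i)\ge1$, the last letter $x$ of $\ell_i$ is not in $\mathcal M^L_I(u_i,U)$, and $u_{i+1}\mid_I xu_i$; (b) $\deg(r_i)\ge1$,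 the first letter $x$ of $r_i$ is not in $\mathcal M^R_I(u_i,U)$, and $u_{i+1}\mid_I u_ix$. Then $I$ is continuous at $w$ if all the pairs $(\ell_i,r_i)$ are distinct, i.e. $(\ell_i,r_i)\neq(\ell_j,r_j)$ for all $i\ne j$. $I$ is continuous if it is continuous at $w$ for all possible $w$.
   Formalization: The cofactors (l_{i+1}, r_{i+1}) are required to come from an involutive factorization of xu_i or u_ix at its place in w; with arbitrary cofactors the claim fails for the left division at w = xx, U = {x}, u_1 = u_2 = x, both pairs (1, x). *)

theory Defs
  imports Main
begin

text \<open>
  The type \<open>'x\<close> is the alphabet of variables (of class \<open>finite\<close> in the theorem, with
  \<open>n = CARD('x)\<close>); a monomial is a word, i.e. an \<open>'x list\<close>, with product \<open>@\<close>, unit \<open>[]\<close> and degree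
  \<open>length\<close>. A division is a total function of \<open>U\<close> and \<open>u\<close>; its values for \<open>U\<close> infinite or \<open>u \<notin> U\<close>
  carry no meaning in general.
\<close>

type_synonym 'x monomial = "'x list"

record 'x division =
  mult_left :: "'x monomial set \<Rightarrow> 'x monomial \<Rightarrow> 'x set"
  mult_right :: "'x monomial set \<Rightarrow> 'x monomial \<Rightarrow> 'x set"

definition left_division :: "'x division" where
  "left_division = \<lparr>mult_left = (\<lambda>U u. UNIV), mult_right = (\<lambda>U u. {})\<rparr>"

definition right_division :: "'x division" where
  "right_division = \<lparr>mult_left = (\<lambda>U u. {}), mult_right = (\<lambda>U u. UNIV)\<rparr>"

text \<open>\<open>inv_factor I U u v v1 v2\<close> says that \<open>v = v1 u v2\<close> exhibits \<open>u\<close> as a (thin) involutive divisor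
  of \<open>v\<close>.\<close>

definition inv_factor ::
  "'x division \<Rightarrow> 'x monomial set \<Rightarrow> 'x monomial \<Rightarrow> 'x monomial \<Rightarrow> 'x monomial \<Rightarrow> 'x monomial \<Rightarrow> bool"
where
  "inv_factor I U u v v1 v2 \<longleftrightarrow>
     v = v1 @ u @ v2 \<and>
     (v1 \<noteq> [] \<longrightarrow> last v1 \<in> mult_left I U u) \<and>
     (v2 \<noteq> [] \<longrightarrow> hd v2 \<in> mult_right I U u)"

definition inv_divides ::
  "'x division \<Rightarrow> 'x monomial set \<Rightarrow> 'x monomial \<Rightarrow> 'x monomial \<Rightarrow> bool"
where
  "inv_divides I U u v \<longleftrightarrow> (\<exists>v1 v2. inv_factor I U u v v1 v2)"

definition divides_left_prolongation ::
  "'x division \<Rightarrow> 'x monomial set \<Rightarrow> 'x monomial \<Rightarrow> 'x monomial \<Rightarrow> 'x monomial \<Rightarrow> bool"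
where
  "divides_left_prolongation I U l u u' \<longleftrightarrow>
     length l \<ge> 1 \<and> last l \<notin> mult_left I U u \<and> inv_divides I U u' (last l # u)"

definition divides_right_prolongation ::
  "'x division \<Rightarrow> 'x monomial set \<Rightarrow> 'x monomial \<Rightarrow> 'x monomial \<Rightarrow> 'x monomial \<Rightarrow> bool"
where
  "divides_right_prolongation I U r u u' \<longleftrightarrow>
     length r \<ge> 1 \<and> hd r \<notin> mult_right I U u \<and> inv_divides I U u' (u @ [hd r])"

text \<open>
  The cofactors of the next term of a sequence are those of the occurrence of \<open>u'\<close> in \<open>w\<close> coming
  from an involutive factorization of the prolongation: if \<open>w = l0 (x u) r\<close> and \<open>x u = v1 u' v2\<close>, then
  \<open>l' = l0 v1\<close> and \<open>r' = v2 r\<close>, and symmetrically on the right. Without this link the left division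
  would not be continuous: for \<open>w = x x\<close> and \<open>U = {x}\<close>, the cofactors \<open>([], x)\<close> could be chosen both
  for \<open>u\<^sub>1 = x\<close> and for \<open>u\<^sub>2 = x\<close>.
\<close>

definition placed_left ::
  "'x division \<Rightarrow> 'x monomial set \<Rightarrow> 'x monomial \<times> 'x monomial \<times> 'x monomial
     \<Rightarrow> 'x monomial \<times> 'x monomial \<times> 'x monomial \<Rightarrow> bool"
where
  "placed_left I U = (\<lambda>(l, u, r) (l', u', r').
     \<exists>v1 v2. inv_factor I U u' (last l # u) v1 v2 \<and> l' = butlast l @ v1 \<and> r' = v2 @ r)"

definition placed_right ::
  "'x division \<Rightarrow> 'x monomial set \<Rightarrow> 'x monomial \<times> 'x monomial \<times> 'x monomial
     \<Rightarrow> 'x monomial \<times> 'x monomial \<times> 'x monomial \<Rightarrow> bool"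
where
  "placed_right I U = (\<lambda>(l, u, r) (l', u', r').
     \<exists>v1 v2. inv_factor I U u' (u @ [hd r]) v1 v2 \<and> l' = l @ v1 \<and> r' = v2 @ tl r)"

definition prolongation_step ::
  "'x division \<Rightarrow> 'x monomial set \<Rightarrow> 'x monomial \<times> 'x monomial \<times> 'x monomial
     \<Rightarrow> 'x monomial \<times> 'x monomial \<times> 'x monomial \<Rightarrow> bool"
where
  "prolongation_step I U = (\<lambda>(l, u, r) (l', u', r').
     (divides_left_prolongation I U l u u' \<and> \<not> divides_right_prolongation I U r u u' \<and>
        placed_left I U (l, u, r) (l', u', r')) \<or>
     (divides_right_prolongation I U r u u' \<and> \<not> divides_left_prolongation I U l u u' \<and>
        placed_right I U (l, u, r) (l', u', r')))"

definition continuous_at :: "'x division \<Rightarrow> 'x monomial \<Rightarrow> bool" where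
  "continuous_at I w \<longleftrightarrow>
     (\<forall>(U :: 'x monomial set) (k :: nat) (l :: nat \<Rightarrow> 'x monomial) u r.
        (\<forall>i. 1 \<le> i \<and> i \<le> k \<longrightarrow> u i \<in> U \<and> w = l i @ u i @ r i) \<and>
        (\<forall>i. 1 \<le> i \<and> i < k \<longrightarrow>
           prolongation_step I U (l i, u i, r i) (l (i + 1), u (i + 1), r (i + 1)))
        \<longrightarrow> (\<forall>i j. 1 \<le> i \<and> i \<le> k \<and> 1 \<le> j \<and> j \<le> k \<and> i \<noteq> j \<longrightarrow> (l i, r i) \<noteq> (l j, r j)))"

definition continuous_division :: "'x division \<Rightarrow> bool" where
  "continuous_division I \<longleftrightarrow> (\<forall>w. continuous_at I w)"

end

theory Submission
  imports Defs
begin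

text \<open>
  A step of the left division drops the first letter of the right cofactor: \<open>u'\<close> divides \<open>u x\<close>
  involutively only as a suffix, so the remaining right cofactor is not lengthened again.
  Hence the lengths of the right cofactors strictly decrease along a sequence. The right division
  is symmetric.
\<close>

text \<open>The measure \<open>\<mu>\<close> sees only the cofactors, so its distinct values
  separate the pairs \<open>(l i, r i)\<close>.\<close>

lemma continuous_if_decreasing:
  fixes \<mu> :: "'x monomial \<Rightarrow> 'x monomial \<Rightarrow> nat"
  assumes dec: "\<And>U l u r l' u' r'.
    prolongation_step I U (l, u, r) (l', u', r') \<Longrightarrow> \<mu> l' r' < \<mu> l r"
  shows "continuous_division I"
  unfolding continuous_division_def continuous_at_def
proof (intro allI impI, elim conjE)
  fix w U k i j and l u r :: "nat \<Rightarrow> 'x monomial"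
  assume steps: "\<forall>i. 1 \<le> i \<and> i < k \<longrightarrow>
      prolongation_step I U (l i, u i, r i) (l (i + 1), u (i + 1), r (i + 1))"
    and bounds: "1 \<le> i" "i \<le> k" "1 \<le> j" "j \<le> k" "i \<noteq> j"
  have Suc_less: "\<mu> (l (Suc a)) (r (Suc a)) < \<mu> (l a) (r a)" if "1 \<le> a" "a < k" for a
    using that steps by (intro dec[of U "l a" "u a" "r a" "l (Suc a)" "u (Suc a)" "r (Suc a)"]) simp
  have less: "\<mu> (l b) (r b) < \<mu> (l a) (r a)" if "a < b" "1 \<le> a" "b \<le> k" for a b
    using that
  \<comment> \<open>Downward induction on \<open>a\<close> with \<open>b\<close> fixed, so
    \<open>1 \<le> a\<close> passes to \<open>Suc a\<close>.\<close>
  proof (induction rule: strict_inc_induct)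
    case (base a)
    then show ?case using Suc_less by simp
  next
    case (step a)
    then show ?case using Suc_less[of a] by simp
  qed
  from \<open>i \<noteq> j\<close> have "\<mu> (l i) (r i) \<noteq> \<mu> (l j) (r j)"
    using less[of i j] less[of j i] bounds by (cases "i < j") auto
  then show "(l i, r i) \<noteq> (l j, r j)" by auto
qed

text \<open>No variable is left nonmultiplicative, so the step is a right one; thinness forces
  \<open>v2 = []\<close>, hence \<open>r' = tl r\<close> with \<open>r\<close> nonempty.\<close>

lemma left_division_step_decreases:
  "prolongation_step left_division U (l, u, r) (l', u', r') \<Longrightarrow> length r' < length r"
  by (auto simp: prolongation_step_def left_division_def divides_left_prolongation_def
      divides_right_prolongation_def placed_right_def inv_factor_def)

text \<open>Mirror image: \<open>v1 = []\<close>, hence \<open>l' = butlast l\<close>.\<close>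

lemma right_division_step_decreases:
  "prolongation_step right_division U (l, u, r) (l', u', r') \<Longrightarrow> length l' < length l"
  by (auto simp: prolongation_step_def right_division_def divides_left_prolongation_def
      divides_right_prolongation_def placed_left_def inv_factor_def)

theorem proposition5p5p7:
  "continuous_division (left_division :: ('x :: finite) division) \<and>
   continuous_division (right_division :: 'x division)"
  using continuous_if_decreasing[of left_division "\<lambda>l r. length r"]
    continuous_if_decreasing[of right_division "\<lambda>l r. length l"]
    left_division_step_decreases right_division_step_decreases
  by blast

end
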